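(* Let $p>1$ and let $x\in C([0,T];\mathbb R)$ be $p$-rough with intrinsic $p$-th variation $[x]^p$. Let $\widehat\pi_n=\Pi(\ell_n,a_n)=\{0=\widehat t^n_0<\dots<\widehat t^n_{N_n}=T\}$ be shifted uniform grids with $\ell_n\to0$, $0\le a_n<\ell_n$, and let $\pi=(\pi_n)$, $\pi_n=\{0=t^n_0<\dots<t^n_{N_n}=T\}$, be partitions with the same number $N_n=N(\pi_n)$ of intervals such that $\delta_n:=\max_{0\le k\le N_n}|t^n_k-\widehat t^n_k|\to0$. Assume $$N(\pi_n)\,\omega_x(\delta_n)^p\longrightarrow0.$$ Then $x\in V_p(\pi)$ and $[x]^p_\pi=[x]^p$.
   Context: $\omega_x(h):=\sup\{|x(t)-x(s)|:s,t\in[0,T],|t-s|\le h\}$. Stopped $p$-energy: for a finite partition $\lambda=\{0=u_0<\dots<u_N=T\}$ and $t\in[0,T]$, $\mathsf V^p_\lambda(x;t):=\sum_{i=0}^{N-1}|x(u_{i+1}\wedge t)-x(u_i\wedge t)|^p$. Shifted uniform grids: for $0<\ell\le T$, $0\le a<\ell$, $\Pi(\ell,a):=\{0,T\}\cup\{a+k\ell: k\in\mathbb Z,\ 0<a+k\ell<T\}$. $p$-roughness: $x\in C([0,T];\mathbb R)$ is $p$-rough if there is a continuous nondecreasing $A:[0,T]\to[0,\infty)$ with $A(T)>A(0)=0$ such that $\sup_{0<\ell\le\delta}\sup_{0\le a<\ell}\sup_{t\in[0,T]}|\mathsf V^p_{\Pi(\ell,a)}(x;t)-A(t)|\to0$ as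 $\delta\downarrow0$. Such an $A$ is unique and denoted $[x]^p$. Finite $p$-th variation along a sequence: for a sequence $\lambda=(\lambda_n)$ of partitions $\lambda_n=\{0=u^n_0<\dots<u^n_{N(\lambda_n)}=T\}$ with mesh tending to $0$, $x\in V_p(\lambda)$ means that the measures $\sum_i|x(u^n_{i+1})-x(u^n_i)|^p\delta_{u^n_i}$ converge weakly to a finite nonatomic Borel measure $\mu^{p,x}_\lambda$ on $[0,T]$; then $[x]^p_\lambda(t):=\mu_\lambda^{p,x}([0,t])$. *)

theory Defs
  imports "HOL-Analysis.Analysis"
begin

(* Paths are functions real => real of which only the restriction to {0..T} matters;
   the time horizon T and the exponent p are explicit arguments. *)

definition modulus :: "real \<Rightarrow> (real \<Rightarrow> real) \<Rightarrow> real \<Rightarrow> real" where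
  "modulus T x h = Sup {\<bar>x t - x s\<bar> | s t. s \<in> {0..T} \<and> t \<in> {0..T} \<and> \<bar>t - s\<bar> \<le> h}"


(* A partition is represented by its finite set of points; its points are listed in
   increasing order as  part_pt P 0 < ... < part_pt P (part_N P). *)

definition is_partition :: "real \<Rightarrow> real set \<Rightarrow> bool" where
  "is_partition T P \<longleftrightarrow> finite P \<and> P \<subseteq> {0..T} \<and> 0 \<in> P \<and> T \<in> P"

definition part_N :: "real set \<Rightarrow> nat" where
  "part_N P = card P - 1"

definition part_pt :: "real set \<Rightarrow> nat \<Rightarrow> real" where
  "part_pt P k = sorted_list_of_set P ! k"

definition mesh :: "real set \<Rightarrow> real" where
  "mesh P = Max ((\<lambda>i. part_pt P (Suc i) - part_pt P i) ` {..<part_N P})"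

definition shifted_grid :: "real \<Rightarrow> real \<Rightarrow> real \<Rightarrow> real set" where
  "shifted_grid T l a =
     {0, T} \<union> {a + of_int k * l | k :: int. 0 < a + of_int k * l \<and> a + of_int k * l < T}"

definition stopped_energy ::
    "real \<Rightarrow> real set \<Rightarrow> (real \<Rightarrow> real) \<Rightarrow> real \<Rightarrow> real" where
  "stopped_energy p P x t =
     (\<Sum>i<part_N P. \<bar>x (min (part_pt P (Suc i)) t) - x (min (part_pt P i) t)\<bar> powr p)"


(* The suprema are taken in ereal, so that an unbounded family has supremum \<infinity>.
   A is extensional outside {0..T}, which makes it unique as a function on the reals. *)

definition is_rough_variation ::
    "real \<Rightarrow> real \<Rightarrow> (real \<Rightarrow> real) \<Rightarrow> (real \<Rightarrow> real) \<Rightarrow> bool" where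
  "is_rough_variation p T x A \<longleftrightarrow>
     A \<in> {0..T} \<rightarrow>\<^sub>E {0..} \<and> continuous_on {0..T} A \<and> mono_on {0..T} A \<and>
     A 0 = 0 \<and> A T > A 0 \<and>
     ((\<lambda>\<delta>. SUP l\<in>{l. 0 < l \<and> l \<le> T \<and> l \<le> \<delta>}. SUP a\<in>{0..<l}. SUP t\<in>{0..T}.
         ereal \<bar>stopped_energy p (shifted_grid T l a) x t - A t\<bar>) \<longlongrightarrow> 0) (at_right 0)"

definition p_rough :: "real \<Rightarrow> real \<Rightarrow> (real \<Rightarrow> real) \<Rightarrow> bool" where
  "p_rough p T x \<longleftrightarrow> continuous_on {0..T} x \<and> (\<exists>A. is_rough_variation p T x A)"

definition rough_variation :: "real \<Rightarrow> real \<Rightarrow> (real \<Rightarrow> real) \<Rightarrow> real \<Rightarrow> real" where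
  "rough_variation p T x = (THE A. is_rough_variation p T x A)"


definition borel_on :: "real \<Rightarrow> real measure" where
  "borel_on T = restrict_space borel {0..T}"

(* The sum of the point masses |x(u_{i+1}) - x(u_i)|^p at the left endpoints u_i, as the
   push-forward of a weighted counting measure on the indices. *)

definition energy_measure ::
    "real \<Rightarrow> real \<Rightarrow> real set \<Rightarrow> (real \<Rightarrow> real) \<Rightarrow> real measure" where
  "energy_measure p T P x =
     distr (point_measure {..<part_N P}
              (\<lambda>i. ennreal (\<bar>x (part_pt P (Suc i)) - x (part_pt P i)\<bar> powr p)))
           (borel_on T) (part_pt P)"

(* Every continuous function on the compact interval {0..T} is bounded. *)

definition weakly_converges ::
    "real \<Rightarrow> (nat \<Rightarrow> real measure) \<Rightarrow> real measure \<Rightarrow> bool" where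
  "weakly_converges T M \<mu> \<longleftrightarrow>
     (\<forall>f :: real \<Rightarrow> real. continuous_on {0..T} f \<longrightarrow>
        (\<lambda>n. integral\<^sup>L (M n) f) \<longlonglongrightarrow> integral\<^sup>L \<mu> f)"

definition nonatomic :: "'a measure \<Rightarrow> bool" where
  "nonatomic \<mu> \<longleftrightarrow>
     \<not> (\<exists>A\<in>sets \<mu>. emeasure \<mu> A > 0 \<and>
          (\<forall>B\<in>sets \<mu>. B \<subseteq> A \<longrightarrow> emeasure \<mu> B = 0 \<or> emeasure \<mu> B = emeasure \<mu> A))"

definition is_limit_measure ::
    "real \<Rightarrow> real \<Rightarrow> (nat \<Rightarrow> real set) \<Rightarrow> (real \<Rightarrow> real) \<Rightarrow> real measure \<Rightarrow> bool" where
  "is_limit_measure p T \<pi> x \<mu> \<longleftrightarrow>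
     sets \<mu> = sets (borel_on T) \<and> finite_measure \<mu> \<and> nonatomic \<mu> \<and>
     weakly_converges T (\<lambda>n. energy_measure p T (\<pi> n) x) \<mu>"

definition Vp :: "real \<Rightarrow> real \<Rightarrow> (nat \<Rightarrow> real set) \<Rightarrow> (real \<Rightarrow> real) set" where
  "Vp p T \<pi> =
     {x. continuous_on {0..T} x \<and>
         (\<forall>n. is_partition T (\<pi> n)) \<and> (\<lambda>n. mesh (\<pi> n)) \<longlonglongrightarrow> 0 \<and>
         (\<exists>\<mu>. is_limit_measure p T \<pi> x \<mu>)}"

definition limit_measure ::
    "real \<Rightarrow> real \<Rightarrow> (nat \<Rightarrow> real set) \<Rightarrow> (real \<Rightarrow> real) \<Rightarrow> real measure" where
  "limit_measure p T \<pi> x = (THE \<mu>. is_limit_measure p T \<pi> x \<mu>)"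

definition variation_along ::
    "real \<Rightarrow> real \<Rightarrow> (nat \<Rightarrow> real set) \<Rightarrow> (real \<Rightarrow> real) \<Rightarrow> real \<Rightarrow> real" where
  "variation_along p T \<pi> x t = measure (limit_measure p T \<pi> x) {0..t}"


definition part_dist :: "real set \<Rightarrow> real set \<Rightarrow> real" where
  "part_dist P Q = Max ((\<lambda>k. \<bar>part_pt P k - part_pt Q k\<bar>) ` {..part_N P})"


lemma is_partition_shifted_grid:
  assumes "0 < l" "l \<le> T" "0 \<le> a" "a < l"
  shows "is_partition T (shifted_grid T l a)"
proof -
  have "{k::int. 0 < a + of_int k * l \<and> a + of_int k * l < T} \<subseteq> {-1..\<lceil>T / l\<rceil>}"
  proof (safe, goal_cases)
    case (1 k)
    then have "0 < (1 + of_int k) * l"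
      using assms by (simp add: algebra_simps)
    then have "(0::real) < 1 + of_int k"
      using assms by (simp add: zero_less_mult_iff)
    moreover have "of_int k \<le> T / l"
      using 1 assms by (simp add: pos_le_divide_eq)
    ultimately show ?case
      by (simp add: le_ceiling_iff)
  qed
  then have "finite {k::int. 0 < a + of_int k * l \<and> a + of_int k * l < T}"
    by (rule finite_subset) simp
  then have "finite ((\<lambda>k::int. a + of_int k * l) `
      {k::int. 0 < a + of_int k * l \<and> a + of_int k * l < T})"
    by (rule finite_imageI)
  also have "((\<lambda>k::int. a + of_int k * l) `
      {k::int. 0 < a + of_int k * l \<and> a + of_int k * l < T}) =
      {a + of_int k * l | k :: int. 0 < a + of_int k * l \<and> a + of_int k * l < T}"
    by auto
  finally show ?thesis
    using assms by (auto simp: is_partition_def shifted_grid_def)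
qed

lemma rough_variation_tendsto:
  assumes "T > 0" "is_rough_variation p T x A" "t \<in> {0..T}"
  shows "((\<lambda>l. stopped_energy p (shifted_grid T l 0) x t) \<longlongrightarrow> A t) (at_right 0)"
proof -
  let ?F = "\<lambda>\<delta>. SUP l\<in>{l. 0 < l \<and> l \<le> T \<and> l \<le> \<delta>}. SUP a\<in>{0..<l}. SUP t\<in>{0..T}.
         ereal \<bar>stopped_energy p (shifted_grid T l a) x t - A t\<bar>"
  have lim: "(?F \<longlongrightarrow> 0) (at_right 0)"
    using assms(2) by (simp add: is_rough_variation_def)
  have "\<forall>\<^sub>F l in at_right 0. 0 < l \<and> l \<le> T"
    using assms(1) by (auto simp: eventually_at_right intro: less_imp_le)
  then have ev: "\<forall>\<^sub>F l in at_right 0.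
      ereal \<bar>stopped_energy p (shifted_grid T l 0) x t - A t\<bar> \<le> ?F l"
  proof eventually_elim
    case (elim l)
    show ?case
      by (rule SUP_upper2[of l], use elim in simp,
          rule SUP_upper2[of 0], use elim in simp,
          rule SUP_upper2[of t], use assms in auto)
  qed
  have "((\<lambda>l. ereal \<bar>stopped_energy p (shifted_grid T l 0) x t - A t\<bar>) \<longlongrightarrow> 0) (at_right 0)"
    by (rule tendsto_sandwich[OF _ ev tendsto_const lim]) simp
  then have "((\<lambda>l. \<bar>stopped_energy p (shifted_grid T l 0) x t - A t\<bar>) \<longlongrightarrow> 0) (at_right 0)"
    unfolding zero_ereal_def lim_ereal .
  then show ?thesis
    by (simp add: tendsto_rabs_zero_iff LIM_zero_iff)
qed

lemma is_rough_variation_unique: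
  assumes "T > 0" "is_rough_variation p T x A" "is_rough_variation p T x B"
  shows "A = B"
proof (rule PiE_ext)
  show "A \<in> {0..T} \<rightarrow>\<^sub>E {0..}" "B \<in> {0..T} \<rightarrow>\<^sub>E {0..}"
    using assms by (auto simp: is_rough_variation_def)
  show "A t = B t" if "t \<in> {0..T}" for t
    using tendsto_unique[OF _ rough_variation_tendsto rough_variation_tendsto] assms that
    by (metis trivial_limit_at_right_real)
qed

lemma rough_variation_eqI:
  assumes "T > 0" "is_rough_variation p T x A"
  shows "rough_variation p T x = A"
  unfolding rough_variation_def
  using assms is_rough_variation_unique by (intro the_equality) auto

lemma part_pt_mem:
  assumes "is_partition T P" "i \<le> part_N P"
  shows "part_pt P i \<in> P"
proof -
  have "0 < card P"
    using assms(1) by (auto simp: is_partition_def card_gt_0_iff)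
  then have "i < length (sorted_list_of_set P)"
    using assms(2) by (simp add: part_N_def)
  then have "part_pt P i \<in> set (sorted_list_of_set P)"
    unfolding part_pt_def by (rule nth_mem)
  then show ?thesis
    using assms(1) by (simp add: is_partition_def)
qed

lemma emeasure_energy_measure:
  assumes "is_partition T P" "A \<in> sets (borel_on T)"
  shows "emeasure (energy_measure p T P x) A =
    (\<Sum>i<part_N P. ennreal (\<bar>x (part_pt P (Suc i)) - x (part_pt P i)\<bar> powr p)
        * indicator A (part_pt P i))"
proof -
  let ?w = "\<lambda>i. ennreal (\<bar>x (part_pt P (Suc i)) - x (part_pt P i)\<bar> powr p)"
  have "part_pt P i \<in> space (borel_on T)" if "i < part_N P" for i
    using part_pt_mem[OF assms(1), of i] that assms(1)
    by (auto simp: borel_on_def space_restrict_space is_partition_def)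
  then have "part_pt P \<in> measurable (point_measure {..<part_N P} ?w) (borel_on T)"
    by (auto simp: measurable_def space_point_measure sets_point_measure)
  then have "emeasure (energy_measure p T P x) A =
      emeasure (point_measure {..<part_N P} ?w) (part_pt P -` A \<inter> {..<part_N P})"
    unfolding energy_measure_def using assms(2)
    by (simp add: emeasure_distr space_point_measure)
  also have "\<dots> = (\<Sum>i\<in>part_pt P -` A \<inter> {..<part_N P}. ?w i)"
    by (intro emeasure_point_measure_finite) auto
  also have "\<dots> = (\<Sum>i<part_N P. ?w i * indicator A (part_pt P i))"
    by (rule sum.mono_neutral_cong_left) (auto simp: indicator_def)
  finally show ?thesis .
qed

end

theory Submission
  imports Defs
begin

text \<open>
  Let \<open>u\<^sub>i\<close> and \<open>v\<^sub>i\<close> be the increments of \<open>x\<close> over the given partition and over the grid. For every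
  \<open>\<epsilon> > 0\<close> there is \<open>C\<close> with \<open>||u|\<^sup>p - |v|\<^sup>p| \<le> \<epsilon> |v|\<^sup>p + C |u - v|\<^sup>p\<close>, and \<open>|u\<^sub>i - v\<^sub>i| \<le> 2 \<omega>(\<delta>)\<close>; since
  the grid energies are bounded, \<open>\<Sum> ||u\<^sub>i|\<^sup>p - |v\<^sub>i|\<^sup>p|\<close> tends to 0, so the two sequences of energy
  measures have the same weak limits. For the grids, the distribution function of the energy measure
  differs from the stopped energy by a single increment, hence converges pointwise to the rough
  variation \<open>A\<close>, and pointwise convergence of distribution functions gives weak convergence to the
  Stieltjes measure of \<open>A\<close>, which has no atoms because \<open>A\<close> is continuous.
\<close>

section \<open>Partitions\<close>

lemma part_pt_strict_mono:
  assumes "is_partition T P" "i < j" "j \<le> part_N P"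
  shows "part_pt P i < part_pt P j"
proof -
  have "0 < card P"
    using assms(1) by (auto simp: is_partition_def card_gt_0_iff)
  then show ?thesis
    using assms sorted_wrt_nth_less[OF strict_sorted_list_of_set, of i j P]
    by (simp add: part_pt_def part_N_def)
qed

lemma part_pt_surj:
  assumes "is_partition T P" "z \<in> P"
  obtains j where "j \<le> part_N P" "z = part_pt P j"
proof -
  have "z \<in> set (sorted_list_of_set P)"
    using assms by (simp add: is_partition_def)
  then obtain j where "j < card P" "z = part_pt P j"
    by (auto simp: in_set_conv_nth part_pt_def)
  then show thesis
    using that[of j] by (simp add: part_N_def)
qed

text \<open>Listed points that follow each other are neighbours in \<open>P\<close>, so a point of
  \<open>P\<close> found strictly inside a gap is a contradiction. The bound on the grid gaps rests
  on this.\<close>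

lemma part_pt_Suc_le:
  assumes "is_partition T P" "z \<in> P" "i < part_N P" "part_pt P i < z"
  shows "part_pt P (Suc i) \<le> z"
proof -
  obtain j where j: "j \<le> part_N P" "z = part_pt P j"
    using part_pt_surj[OF assms(1,2)] .
  have "i < j"
    using part_pt_strict_mono[OF assms(1), of j i] assms(3,4) j
    by (metis less_imp_le linorder_neqE_nat order_less_asym order_less_irrefl)
  then show ?thesis
    using part_pt_strict_mono[OF assms(1), of "Suc i" j] j
    by (cases "Suc i = j") auto
qed

lemma part_pt_bounds:
  assumes "is_partition T P" "i \<le> part_N P"
  shows "0 \<le> part_pt P i" "part_pt P i \<le> T"
  using part_pt_mem[OF assms] assms(1) by (auto simp: is_partition_def)

lemma part_N_pos:
  assumes "is_partition T P" "T > 0"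
  shows "part_N P > 0"
proof -
  have "card {0, T} \<le> card P"
    using assms(1) by (intro card_mono) (auto simp: is_partition_def)
  then show ?thesis
    using assms(2) by (simp add: part_N_def)
qed

text \<open>The intervals [\<open>part_pt P i\<close>, \<open>part_pt P (Suc i)\<close>) are
  pairwise disjoint, because the right end of an earlier one never exceeds the left end of a later
  one.\<close>

lemma card_straddling_le_1:
  assumes "is_partition T P"
  shows "card {i. i < part_N P \<and> part_pt P i \<le> t \<and> t < part_pt P (Suc i)} \<le> 1"
proof -
  have *: "i = j" if "i < part_N P" "part_pt P i \<le> t" "t < part_pt P (Suc i)"
    "j < part_N P" "part_pt P j \<le> t" "t < part_pt P (Suc j)" for i j
  proof (rule ccontr)
    have key: False if "i < j" "j < part_N P" "part_pt P j \<le> t" "t < part_pt P (Suc i)" for i j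
      using part_pt_strict_mono[OF assms, of "Suc i" j] that
      by (cases "Suc i = j") auto
    assume "i \<noteq> j"
    then show False
      using key[of i j] key[of j i] that by linarith
  qed
  then show ?thesis
    by (intro card_le_Suc0_iff_eq[THEN iffD2, unfolded One_nat_def[symmetric]]) auto
qed

text \<open>The first lattice point strictly to the right of \<open>?u\<close> is at distance at
  most \<open>l\<close>. In a longer gap it would lie strictly between two neighbouring grid points,
  and hence strictly between 0 and \<open>T\<close>, where every lattice point belongs to the
  grid.\<close>

lemma shifted_grid_gap_le:
  assumes "0 < l" "l \<le> T" "0 \<le> a" "a < l" "i < part_N (shifted_grid T l a)"
  shows "part_pt (shifted_grid T l a) (Suc i) - part_pt (shifted_grid T l a) i \<le> l"
proof (rule ccontr)
  let ?P = "shifted_grid T l a"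
  let ?u = "part_pt ?P i" and ?v = "part_pt ?P (Suc i)"
  have P: "is_partition T ?P"
    using is_partition_shifted_grid assms by simp
  assume "\<not> ?v - ?u \<le> l"
  \<comment> \<open>Floor plus one rather than ceiling, so that the lattice point lies strictly
    beyond \<open>?u\<close> even when \<open>?u\<close> is itself a lattice point.\<close>
  define k where "k = \<lfloor>(?u - a) / l\<rfloor> + 1"
  have "(?u - a) / l < of_int k" "of_int k \<le> (?u - a) / l + 1"
    unfolding k_def by linarith+
  then have "?u < a + of_int k * l" "a + of_int k * l \<le> ?u + l"
    using assms(1) by (simp_all add: field_simps)
  moreover have "0 \<le> ?u" "?v \<le> T"
    using part_pt_bounds[OF P] assms(5) by auto
  ultimately have k: "?u < a + of_int k * l" "a + of_int k * l < ?v"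
    and "0 < a + of_int k * l" "a + of_int k * l < T"
    using \<open>\<not> ?v - ?u \<le> l\<close> by linarith+
  then have "a + of_int k * l \<in> ?P"
    unfolding shifted_grid_def by blast
  then show False
    using part_pt_Suc_le[OF P _ assms(5)] k by fastforce
qed

lemma part_dist_ge:
  assumes "k \<le> part_N P"
  shows "\<bar>part_pt P k - part_pt Q k\<bar> \<le> part_dist P Q"
  unfolding part_dist_def using assms by (intro Max_ge) auto

lemma mesh_nonneg:
  assumes "is_partition T P" "T > 0"
  shows "0 \<le> mesh P"
proof -
  have "part_pt P (Suc 0) - part_pt P 0 \<le> mesh P"
    unfolding mesh_def using part_N_pos[OF assms] by (intro Max_ge) auto
  then show ?thesis
    using part_pt_strict_mono[OF assms(1), of 0 "Suc 0"] part_N_pos[OF assms] by simp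
qed

text \<open>Both endpoints of an interval move by at most \<open>part_dist P Q\<close>, which
  accounts for the factor 2.\<close>

lemma mesh_le_gap_plus_part_dist:
  assumes "is_partition T P" "T > 0" "part_N P = part_N Q"
    and "\<And>i. i < part_N Q \<Longrightarrow> part_pt Q (Suc i) - part_pt Q i \<le> h"
  shows "mesh P \<le> h + 2 * part_dist P Q"
  unfolding mesh_def
proof (rule Max.boundedI)
  fix y assume "y \<in> (\<lambda>i. part_pt P (Suc i) - part_pt P i) ` {..<part_N P}"
  then obtain i where "i < part_N P" "y = part_pt P (Suc i) - part_pt P i"
    by auto
  then show "y \<le> h + 2 * part_dist P Q"
    using part_dist_ge[of i P Q] part_dist_ge[of "Suc i" P Q] assms(3) assms(4)[of i] by simp
qed (use part_N_pos[OF assms(1,2)] in auto)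

text \<open>A real \<open>Sup\<close> dominates its members only when the set is bounded above; here
  the boundedness comes from continuity on a compact interval.\<close>

lemma modulus_ge:
  assumes "continuous_on {0..T} x" "s \<in> {0..T}" "t \<in> {0..T}" "\<bar>t - s\<bar> \<le> h"
  shows "\<bar>x t - x s\<bar> \<le> modulus T x h"
proof -
  have "bounded (x ` {0..T})"
    using assms(1) by (intro compact_imp_bounded compact_continuous_image) auto
  then obtain B where B: "\<And>u. u \<in> {0..T} \<Longrightarrow> \<bar>x u\<bar> \<le> B"
    unfolding bounded_iff real_norm_def by blast
  have "bdd_above {\<bar>x t - x s\<bar> | s t. s \<in> {0..T} \<and> t \<in> {0..T} \<and> \<bar>t - s\<bar> \<le> h}"
  proof (rule bdd_aboveI)
    fix y assume "y \<in> {\<bar>x t - x s\<bar> | s t. s \<in> {0..T} \<and> t \<in> {0..T} \<and> \<bar>t - s\<bar> \<le> h}"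
    then obtain s t where "y = \<bar>x t - x s\<bar>" "s \<in> {0..T}" "t \<in> {0..T}" by blast
    then show "y \<le> B + B"
      using B[of s] B[of t] by linarith
  qed
  then show ?thesis
    unfolding modulus_def using assms(2-4) by (intro cSup_upper) auto
qed

section \<open>Finite measures on the interval\<close>

lemma space_borel_on: "space (borel_on T) = {0..T}"
  by (simp add: borel_on_def space_restrict_space)

lemma sets_borel_on_iff: "A \<in> sets (borel_on T) \<longleftrightarrow> A \<in> sets borel \<and> A \<subseteq> {0..T}"
  unfolding borel_on_def by (subst sets_restrict_space_iff) auto

lemma space_eq_if_sets_borel_on: "sets M = sets (borel_on T) \<Longrightarrow> space M = {0..T}"
  using sets_eq_imp_space_eq[of M "borel_on T"] by (simp add: space_borel_on)

lemma measurable_if_continuous_borel_on: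
  fixes f :: "real \<Rightarrow> real"
  assumes "sets M = sets (borel_on T)" "continuous_on {0..T} f"
  shows "f \<in> borel_measurable M"
  using borel_measurable_continuous_on_restrict[OF assms(2)] assms(1)
  by (simp add: borel_on_def cong: measurable_cong_sets)

lemma integrable_if_continuous_borel_on:
  fixes f :: "real \<Rightarrow> real"
  assumes "sets M = sets (borel_on T)" "finite_measure M" "continuous_on {0..T} f"
  shows "integrable M f"
proof -
  interpret finite_measure M by fact
  have "bounded (f ` {0..T})"
    using assms(3) by (intro compact_imp_bounded compact_continuous_image) auto
  then obtain B where "\<And>u. u \<in> {0..T} \<Longrightarrow> \<bar>f u\<bar> \<le> B"
    unfolding bounded_iff real_norm_def by blast
  then show ?thesis
    using measurable_if_continuous_borel_on[OF assms(1,3)]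
    by (intro integrable_const_bound[of _ B] AE_I2)
       (auto simp: space_eq_if_sets_borel_on[OF assms(1)])
qed

text \<open>After a push-forward to the whole line along \<open>id\<close>, it suffices to compare
  open rays \<open>{t<..}\<close>. Inside [0,T] such a ray is everything, nothing, or the complement
  of \<open>{0..t}\<close>.\<close>

lemma measure_eqI_Icc_borel_on:
  assumes M: "sets M = sets (borel_on T)" "finite_measure M"
    and N: "sets N = sets (borel_on T)" "finite_measure N"
    and eq: "\<And>t. t \<in> {0..T} \<Longrightarrow> measure M {0..t} = measure N {0..t}" and "T \<ge> 0"
  shows "M = N"
proof -
  interpret M: finite_measure M by fact
  interpret N: finite_measure N by fact
  have idM: "id \<in> measurable M borel" and idN: "id \<in> measurable N borel"
    using measurable_if_continuous_borel_on[OF M(1)] measurable_if_continuous_borel_on[OF N(1)]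
    by (auto simp: id_def)
  have spM: "space M = {0..T}" and spN: "space N = {0..T}"
    using M N space_eq_if_sets_borel_on by blast+
  have inM: "{0..t} \<in> sets M" "{0..t} \<in> sets N" if "t \<in> {0..T}" for t
    using that M(1) N(1) by (auto simp: sets_borel_on_iff)
  have distrM: "emeasure (distr M borel id) A = emeasure M (A \<inter> {0..T})"
   and distrN: "emeasure (distr N borel id) A = emeasure N (A \<inter> {0..T})" if "A \<in> sets borel" for A
    using that by (simp_all add: emeasure_distr[OF idM] emeasure_distr[OF idN] spM spN)
  have "distr M borel id = distr N borel id"
  proof (rule measure_eqI_lessThan)
    fix t :: real
    show "emeasure (distr M borel id) {t<..} < \<infinity>"
      by (simp add: distrM M.emeasure_finite less_top[symmetric])
    have eqT: "measure M {0..T} = measure N {0..T}"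
      using eq[of T] assms(6) by simp
    consider "t < 0" | "t \<in> {0..T}" | "t > T" by fastforce
    then have "measure M ({t<..} \<inter> {0..T}) = measure N ({t<..} \<inter> {0..T})"
    proof cases
      case 1
      then have "{t<..} \<inter> {0..T} = {0..T}" by auto
      then show ?thesis using eqT by simp
    next
      case 2
      then have "{t<..} \<inter> {0..T} = {0..T} - {0..t}" by auto
      then show ?thesis
        using eqT eq[OF 2] inM[OF 2] inM[of T] 2
          M.finite_measure_Diff[of "{0..T}" "{0..t}"] N.finite_measure_Diff[of "{0..T}" "{0..t}"]
        by auto
    next
      case 3
      then have "{t<..} \<inter> {0..T} = {}" by auto
      then show ?thesis by simp
    qed
    then show "emeasure (distr M borel id) {t<..} = emeasure (distr N borel id) {t<..}"
      by (simp add: distrM distrN M.emeasure_eq_measure N.emeasure_eq_measure)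
  qed simp_all
  show ?thesis
  proof (rule measure_eqI)
    show "sets M = sets N" using M N by simp
    fix A assume "A \<in> sets M"
    then have "A \<in> sets borel" "A \<inter> {0..T} = A"
      using M(1) by (auto simp: sets_borel_on_iff)
    then show "emeasure M A = emeasure N A"
      using distrM[of A] distrN[of A] \<open>distr M borel id = distr N borel id\<close> by simp
  qed
qed

text \<open>The ramps equal 1 up to \<open>t\<close> and then fall linearly to 0 over a length
  \<open>1/k\<close>. They tend pointwise to the indicator of \<open>{0..t}\<close> and are
  dominated by 1, so continuous test functions recover the distribution function.\<close>

lemma integral_ramp_tendsto_measure_Icc:
  assumes M: "sets M = sets (borel_on T)" "finite_measure M" and t: "t \<in> {0..T}"
  shows "(\<lambda>k. \<integral>y. max 0 (min 1 (1 - real k * (y - t))) \<partial>M) \<longlonglongrightarrow> measure M {0..t}"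
proof -
  interpret finite_measure M by fact
  have sp: "space M = {0..T}"
    using M space_eq_if_sets_borel_on by blast
  have set: "{0..t} \<in> sets M"
    using t M(1) by (auto simp: sets_borel_on_iff)
  have "(\<lambda>k. \<integral>y. max 0 (min 1 (1 - real k * (y - t))) \<partial>M) \<longlonglongrightarrow> (\<integral>y. indicator {0..t} y \<partial>M)"
  proof (rule integral_dominated_convergence[where w = "\<lambda>_. 1"])
    show "AE y in M. (\<lambda>k. max 0 (min 1 (1 - real k * (y - t)))) \<longlonglongrightarrow> indicator {0..t} y"
    proof (rule AE_I2)
      fix y assume y: "y \<in> space M"
      show "(\<lambda>k. max 0 (min 1 (1 - real k * (y - t)))) \<longlonglongrightarrow> indicator {0..t} y"
      proof (cases "y \<le> t")
        case True
        then have "max 0 (min 1 (1 - real k * (y - t))) = 1" for k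
          by (auto simp: mult_nonneg_nonpos)
        then show ?thesis using True y sp by simp
      next
        case False
        \<comment> \<open>From this index on the ramp has reached 0 before \<open>y\<close>.\<close>
        obtain n :: nat where n: "1 / (y - t) < n"
          using reals_Archimedean2 by blast
        have "max 0 (min 1 (1 - real k * (y - t))) = 0" if "k \<ge> n" for k
        proof -
          have "1 / (y - t) \<le> real k"
            using n that by linarith
          then show ?thesis
            using False by (simp add: field_simps)
        qed
        then have "\<forall>\<^sub>F k in sequentially. max 0 (min 1 (1 - real k * (y - t))) = 0"
          using eventually_sequentially by blast
        then show ?thesis
          using False by (simp add: tendsto_eventually)
      qed
    qed
    show "(\<lambda>y. max 0 (min 1 (1 - real k * (y - t)))) \<in> borel_measurable M" for k
      by (intro measurable_if_continuous_borel_on[OF M(1)] continuous_intros)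
  qed (use set in auto)
  then show ?thesis
    using set by simp
qed

lemma measure_eqI_continuous_borel_on:
  assumes M: "sets M = sets (borel_on T)" "finite_measure M"
    and N: "sets N = sets (borel_on T)" "finite_measure N"
    and eq: "\<And>f :: real \<Rightarrow> real. continuous_on {0..T} f \<Longrightarrow> integral\<^sup>L M f = integral\<^sup>L N f"
    and "T \<ge> 0"
  shows "M = N"
proof (rule measure_eqI_Icc_borel_on[OF M N _ \<open>T \<ge> 0\<close>])
  fix t assume t: "t \<in> {0..T}"
  have "(\<integral>y. max 0 (min 1 (1 - real k * (y - t))) \<partial>M)
      = (\<integral>y. max 0 (min 1 (1 - real k * (y - t))) \<partial>N)" for k
    by (intro eq continuous_intros)
  then show "measure M {0..t} = measure N {0..t}"
    using LIMSEQ_unique[OF integral_ramp_tendsto_measure_Icc[OF M t]]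
      integral_ramp_tendsto_measure_Icc[OF N t] by simp
qed

text \<open>Two weak limits of one sequence have the same integrals of continuous functions. This
  makes the definite description in \<open>limit_measure\<close> meaningful.\<close>

lemma is_limit_measure_unique:
  assumes "is_limit_measure p T \<pi> x \<mu>" "is_limit_measure p T \<pi> x \<nu>" "T \<ge> 0"
  shows "\<mu> = \<nu>"
  using assms
  by (intro measure_eqI_continuous_borel_on[of _ T])
     (auto simp: is_limit_measure_def weakly_converges_def intro: LIMSEQ_unique)

section \<open>Convergence of distribution functions\<close>

text \<open>A step approximation of \<open>f\<close> on \<open>m\<close> equal cells, with the value
  at the right endpoint. The cells are left-open so that their masses are increments of the
  distribution function; the point 0, which no cell contains, gets its own term.\<close>

definition right_step :: "real \<Rightarrow> nat \<Rightarrow> (real \<Rightarrow> real) \<Rightarrow> real \<Rightarrow> real" where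
  "right_step T m f y = f 0 * indicator {0} y +
     (\<Sum>j<m. f (real (Suc j) * T / m) * indicator {real j * T / m<..real (Suc j) * T / m} y)"

lemma right_step_close:
  assumes "T > 0" "m > 0" "y \<in> {0..T}"
    and osc: "\<And>s t. s \<in> {0..T} \<Longrightarrow> t \<in> {0..T} \<Longrightarrow> \<bar>t - s\<bar> \<le> T / m \<Longrightarrow> \<bar>f t - f s\<bar> \<le> e"
  shows "\<bar>f y - right_step T m f y\<bar> \<le> e"
proof (cases "y = 0")
  case True
  moreover have "0 \<le> real j * T / m" for j
    using assms(1,2) by simp
  then have "(\<Sum>j<m. f (real (Suc j) * T / m) *
      indicator {real j * T / m<..real (Suc j) * T / m} (0::real)) = 0"
    by (intro sum.neutral) (simp add: not_less)
  ultimately have "right_step T m f y = f 0"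
    by (simp add: right_step_def)
  then show ?thesis
    using True osc[of 0 0] assms by simp
next
  case False
  \<comment> \<open>The index of the cell containing \<open>y\<close>. Ceiling minus one assigns a
    cell boundary to the cell that ends there, in agreement with the left-open cells.\<close>
  define k where "k = nat (\<lceil>y * m / T\<rceil> - 1)"
  have "0 < y * m / T"
    using False assms by simp
  then have "real k < y * m / T" "y * m / T \<le> real (Suc k)"
    unfolding k_def by linarith+
  then have ky: "real k * T / m < y" "y \<le> real (Suc k) * T / m"
    using assms(1,2) by (simp_all add: field_simps)
  have "y * m / T \<le> m"
    using assms by (simp add: field_simps)
  then have "k < m"
    using \<open>real k < y * m / T\<close> by linarith
  have unique: "j = k" if "real j * T / m < y" "y \<le> real (Suc j) * T / m" for j
  proof -
    have "real j * T / m < real (Suc k) * T / m" "real k * T / m < real (Suc j) * T / m"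
      using that ky by linarith+
    then show ?thesis
      using assms(1,2) by (auto simp: divide_less_cancel)
  qed
  have "y \<in> {real j * T / m<..real (Suc j) * T / m} \<longleftrightarrow> j = k" for j
    unfolding greaterThanAtMost_iff using unique ky by blast
  then have "indicator {real j * T / m<..real (Suc j) * T / m} y = (of_bool (j = k) :: real)" for j
    by (simp only: indicator_def of_bool_def)
  then have "(\<Sum>j<m. f (real (Suc j) * T / m) * indicator {real j * T / m<..real (Suc j) * T / m} y)
      = (\<Sum>j<m. if j = k then f (real (Suc k) * T / m) else 0)"
    by (intro sum.cong) simp_all
  then have "right_step T m f y = f (real (Suc k) * T / m)"
    using False \<open>k < m\<close> by (simp add: right_step_def)
  moreover have "real (Suc k) * T / m \<le> T"
    using mult_right_mono[of "real (Suc k)" "real m" T] \<open>k < m\<close> assms(1,2)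
    by (simp add: pos_divide_le_eq mult.commute)
  moreover have "real (Suc k) * T / m = real k * T / m + T / m"
    by (simp add: field_simps add_divide_distrib)
  then have "\<bar>y - real (Suc k) * T / m\<bar> \<le> T / m"
    using ky by linarith
  ultimately show ?thesis
    using osc[of "real (Suc k) * T / m" y] assms by auto
qed

text \<open>Only values of the distribution function at the finitely many points
  \<open>j * T / m\<close> occur, so pointwise convergence of distribution functions carries over to
  these integrals.\<close>

lemma integral_right_step:
  assumes M: "sets M = sets (borel_on T)" "finite_measure M" and "T > 0" "m > 0"
  shows "integrable M (right_step T m f)"
    and "integral\<^sup>L M (right_step T m f) = f 0 * measure M {0..0} +
     (\<Sum>j<m. f (real (Suc j) * T / m) *
        (measure M {0..real (Suc j) * T / m} - measure M {0..real j * T / m}))"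
proof -
  interpret finite_measure M by fact
  let ?s = "\<lambda>j. real j * T / m"
  have sT: "?s j \<in> {0..T}" if "j \<le> m" for j
    using that assms(3,4) by (simp add: field_simps)
  have s0: "{0} \<in> sets M"
    using M(1) assms(3) by (auto simp: sets_borel_on_iff)
  have sI: "{?s j<..?s (Suc j)} \<in> sets M" if "j < m" for j
    using M(1) sT[of j] sT[of "Suc j"] that by (auto simp: sets_borel_on_iff)
  have int: "integrable M (\<lambda>y. c * indicator {?s j<..?s (Suc j)} y)" if "j < m" for j and c :: real
    using sI[OF that] by (intro integrable_mult_right integrable_real_indicator)
      (auto simp: emeasure_eq_measure)
  have int0: "integrable M (\<lambda>y. c * indicator {0} y)" for c :: real
    using s0 by (intro integrable_mult_right integrable_real_indicator)
      (auto simp: emeasure_eq_measure)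
  show "integrable M (right_step T m f)"
    unfolding right_step_def using int int0
    by (intro Bochner_Integration.integrable_add Bochner_Integration.integrable_sum) auto
  have diff: "measure M {?s j<..?s (Suc j)} = measure M {0..?s (Suc j)} - measure M {0..?s j}"
    if "j < m" for j
  proof -
    have "?s j \<le> ?s (Suc j)"
      using assms(3,4) by (simp add: divide_right_mono)
    then have "{?s j<..?s (Suc j)} = {0..?s (Suc j)} - {0..?s j}" "{0..?s j} \<subseteq> {0..?s (Suc j)}"
      using sT[of j] that by auto
    moreover have "{0..?s j} \<in> sets M" "{0..?s (Suc j)} \<in> sets M"
      using M(1) sT[of j] sT[of "Suc j"] that by (auto simp: sets_borel_on_iff)
    ultimately show ?thesis
      using finite_measure_Diff by metis
  qed
  have "integral\<^sup>L M (right_step T m f) = f 0 * measure M {0} +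
      (\<Sum>j<m. f (?s (Suc j)) * measure M {?s j<..?s (Suc j)})"
    unfolding right_step_def using int int0 s0 sI
    by (subst Bochner_Integration.integral_add, simp, 
        intro Bochner_Integration.integrable_sum, simp,
        subst Bochner_Integration.integral_sum) auto
  then show "integral\<^sup>L M (right_step T m f) = f 0 * measure M {0..0} +
     (\<Sum>j<m. f (?s (Suc j)) * (measure M {0..?s (Suc j)} - measure M {0..?s j}))"
    using diff by simp
qed

text \<open>Uniform continuity brings \<open>f\<close> uniformly close to a step function, whose
  integrals converge. The replacement error is controlled by the total masses, which converge as
  well.\<close>

lemma weakly_converges_if_measure_Icc_tendsto:
  assumes M: "\<And>n. sets (M n) = sets (borel_on T)" "\<And>n. finite_measure (M n)"
    and \<mu>: "sets \<mu> = sets (borel_on T)" "finite_measure \<mu>"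
    and lim: "\<And>t. t \<in> {0..T} \<Longrightarrow> (\<lambda>n. measure (M n) {0..t}) \<longlonglongrightarrow> measure \<mu> {0..t}"
    and "T > 0"
  shows "weakly_converges T M \<mu>"
  unfolding weakly_converges_def
proof (intro allI impI)
  fix f :: "real \<Rightarrow> real" assume f: "continuous_on {0..T} f"
  \<comment> \<open>Stated for an arbitrary finite measure \<open>N\<close>, since it is applied
    both to the approximating measures and to the limit.\<close>
  have bound: "\<bar>integral\<^sup>L N f - integral\<^sup>L N (right_step T m f)\<bar> \<le> e * measure N {0..T}"
    if N: "sets N = sets (borel_on T)" "finite_measure N" and "m > 0"
      and close: "\<And>y. y \<in> {0..T} \<Longrightarrow> \<bar>f y - right_step T m f y\<bar> \<le> e" for N e m
  proof -
    interpret finite_measure N by fact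
    have sp: "space N = {0..T}"
      using N space_eq_if_sets_borel_on by blast
    have i: "integrable N (\<lambda>y. f y - right_step T m f y)"
      using integrable_if_continuous_borel_on[OF N f]
        integral_right_step(1)[OF N \<open>T > 0\<close> \<open>m > 0\<close>] by simp
    have "\<bar>integral\<^sup>L N f - integral\<^sup>L N (right_step T m f)\<bar>
        = \<bar>\<integral>y. f y - right_step T m f y \<partial>N\<bar>"
      using integrable_if_continuous_borel_on[OF N f]
        integral_right_step(1)[OF N \<open>T > 0\<close> \<open>m > 0\<close>] by simp
    also have "\<dots> \<le> (\<integral>y. \<bar>f y - right_step T m f y\<bar> \<partial>N)"
      by (rule integral_abs_bound)
    also have "\<dots> \<le> (\<integral>y. e \<partial>N)"
      using i close by (intro integral_mono) (auto simp: sp)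
    finally show ?thesis
      by (simp add: sp mult.commute)
  qed
  show "(\<lambda>n. integral\<^sup>L (M n) f) \<longlonglongrightarrow> integral\<^sup>L \<mu> f"
  proof (rule LIMSEQ_I)
    fix r :: real assume "r > 0"
    define B where "B = measure \<mu> {0..T}"
    have "B \<ge> 0" by (simp add: B_def)
    \<comment> \<open>Chosen so that \<open>e * (B + 1) = r / 4\<close>: two replacement errors and
      the step error then add up to less than \<open>r\<close>. The extra 1 leaves room for total
      masses slightly above the limit \<open>B\<close>.\<close>
    define e where "e = r / (4 * (B + 1))"
    have "e > 0" using \<open>r > 0\<close> \<open>B \<ge> 0\<close> by (simp add: e_def)
    have eB: "e * (B + 1) = r / 4" using \<open>B \<ge> 0\<close> by (simp add: e_def field_simps)
    have "uniformly_continuous_on {0..T} f"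
      using f by (intro compact_uniformly_continuous) auto
    then obtain d where "d > 0"
      and d: "\<And>s t. s \<in> {0..T} \<Longrightarrow> t \<in> {0..T} \<Longrightarrow> \<bar>t - s\<bar> < d \<Longrightarrow> \<bar>f t - f s\<bar> < e"
      unfolding uniformly_continuous_on_def dist_real_def using \<open>e > 0\<close> by metis
    obtain m :: nat where m: "T / d < m"
      using reals_Archimedean2 by blast
    have "m > 0"
      using m \<open>T > 0\<close> \<open>d > 0\<close> by (metis divide_pos_pos of_nat_0_less_iff order_less_trans)
    then have "T / m < d"
      using m \<open>d > 0\<close> by (simp add: field_simps)
    then have close: "\<bar>f y - right_step T m f y\<bar> \<le> e" if "y \<in> {0..T}" for y
      using d that by (intro right_step_close[OF \<open>T > 0\<close> \<open>m > 0\<close>]) force+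
    have sT: "real j * T / m \<in> {0..T}" if "j \<le> m" for j
      using that \<open>T > 0\<close> \<open>m > 0\<close> by (simp add: field_simps)
    have step: "(\<lambda>n. integral\<^sup>L (M n) (right_step T m f)) \<longlonglongrightarrow> integral\<^sup>L \<mu> (right_step T m f)"
      unfolding integral_right_step(2)[OF M \<open>T > 0\<close> \<open>m > 0\<close>]
        integral_right_step(2)[OF \<mu> \<open>T > 0\<close> \<open>m > 0\<close>]
      using \<open>T > 0\<close> by (intro tendsto_intros lim sT) auto
    have "r / 4 > 0" using \<open>r > 0\<close> by simp
    then have "\<forall>\<^sub>F n in sequentially.
        \<bar>integral\<^sup>L (M n) (right_step T m f) - integral\<^sup>L \<mu> (right_step T m f)\<bar> < r / 4"
      using tendstoD[OF step] unfolding dist_real_def by blast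
    moreover have "\<forall>\<^sub>F n in sequentially. measure (M n) {0..T} < B + 1"
      using lim[of T] \<open>T > 0\<close> unfolding B_def by (intro order_tendstoD(2)) auto
    ultimately have "\<forall>\<^sub>F n in sequentially. \<bar>integral\<^sup>L (M n) f - integral\<^sup>L \<mu> f\<bar> < r"
    proof eventually_elim
      case (elim n)
      have "e * measure (M n) {0..T} \<le> r / 4" "e * measure \<mu> {0..T} \<le> r / 4"
        unfolding eB[symmetric] using elim \<open>e > 0\<close> by (simp_all add: B_def)
      then show ?case
        using elim(1) bound[OF M \<open>m > 0\<close> close, of n] bound[OF \<mu> \<open>m > 0\<close> close] \<open>r > 0\<close>
        by linarith
    qed
    then show "\<exists>N. \<forall>n\<ge>N. norm (integral\<^sup>L (M n) f - integral\<^sup>L \<mu> f) < r"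
      by (simp add: eventually_sequentially)
  qed
qed

section \<open>The measure with a given continuous distribution function\<close>

text \<open>For a set \<open>A\<close> of positive mass, the mass of \<open>A\<close> up to
  \<open>t\<close> depends continuously on \<open>t\<close> and runs from 0 to the mass of
  \<open>A\<close>. At an intermediate time it is exactly one half, which rules out an atom.\<close>

lemma nonatomic_if_continuous_Icc:
  assumes \<mu>: "sets \<mu> = sets (borel_on T)" "finite_measure \<mu>"
    and cont: "continuous_on {0..T} (\<lambda>t. measure \<mu> {0..t})"
    and "measure \<mu> {0..0} = 0" "T \<ge> 0"
  shows "nonatomic \<mu>"
  unfolding nonatomic_def
proof safe
  interpret finite_measure \<mu> by fact
  fix A assume A: "A \<in> sets \<mu>" "0 < emeasure \<mu> A"
    and atom: "\<forall>B\<in>sets \<mu>. B \<subseteq> A \<longrightarrow> emeasure \<mu> B = 0 \<or> emeasure \<mu> B = emeasure \<mu> A"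
  have mA: "0 < measure \<mu> A"
    using A(2) by (simp add: emeasure_eq_measure)
  have Icc: "{0..t} \<in> sets \<mu>" if "t \<le> T" for t
    using \<mu>(1) that by (auto simp: sets_borel_on_iff)
  define g where "g t = measure \<mu> (A \<inter> {0..t})" for t
  \<comment> \<open>The increments of \<open>g\<close> are dominated by those of the distribution
    function, from which \<open>g\<close> inherits continuity.\<close>
  have mono: "0 \<le> g t - g s \<and> g t - g s \<le> measure \<mu> {0..t} - measure \<mu> {0..s}"
    if "s \<le> t" "t \<le> T" for s t
  proof -
    have sub: "A \<inter> {0..s} \<subseteq> A \<inter> {0..t}" "{0..s} \<subseteq> {0..t}"
      using that by auto
    have "g t - g s = measure \<mu> (A \<inter> {0..t} - A \<inter> {0..s})"
      unfolding g_def using sub A Icc that by (subst finite_measure_Diff) auto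
    also have "\<dots> \<le> measure \<mu> ({0..t} - {0..s})"
      using A Icc that by (intro finite_measure_mono) auto
    also have "\<dots> = measure \<mu> {0..t} - measure \<mu> {0..s}"
      using sub Icc that by (intro finite_measure_Diff) auto
    finally show ?thesis
      using finite_measure_mono[OF sub(1)] A Icc that by (auto simp: g_def)
  qed
  then have "\<bar>g t - g s\<bar> \<le> \<bar>measure \<mu> {0..t} - measure \<mu> {0..s}\<bar>"
    if "s \<in> {0..T}" "t \<in> {0..T}" for s t
  proof (cases "s \<le> t")
    case True
    then show ?thesis using mono[OF True] that(2) by simp
  next
    case False
    then have "t \<le> s" by simp
    then show ?thesis using mono[of t s] that(1) by simp
  qed
  then have "continuous_on {0..T} g"
    using cont unfolding continuous_on_iff dist_real_def
    by (meson order_le_less_trans)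
  moreover have "g 0 \<le> measure \<mu> {0..0}"
    unfolding g_def using Icc[of 0] assms(5) by (intro finite_measure_mono) auto
  then have "g 0 \<le> measure \<mu> A / 2"
    using mA assms(4) by linarith
  moreover have "A \<inter> {0..T} = A"
    using A(1) \<mu>(1) by (auto simp: sets_borel_on_iff)
  then have "measure \<mu> A / 2 \<le> g T"
    using mA by (simp add: g_def)
  ultimately obtain t where t: "0 \<le> t" "t \<le> T" "g t = measure \<mu> A / 2"
    using IVT'[of g 0 "measure \<mu> A / 2" T] assms(5) by blast
  have "A \<inter> {0..t} \<in> sets \<mu>"
    using A Icc t by auto
  then show False
    using atom[rule_format, of "A \<inter> {0..t}"] t(3) mA by (auto simp: emeasure_eq_measure g_def)
qed

text \<open>This is the Stieltjes measure of \<open>A\<close>, restricted to [0,T].\<close>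

lemma obtain_measure_of_continuous_mono:
  assumes "continuous_on {0..T} A" "mono_on {0..T} A" "A 0 = 0" "T > 0"
  obtains \<mu> where "sets \<mu> = sets (borel_on T)" "finite_measure \<mu>"
    "\<And>t. t \<in> {0..T} \<Longrightarrow> measure \<mu> {0..t} = A t"
proof
  \<comment> \<open>Clamping the argument extends \<open>A\<close> to a continuous nondecreasing
    function on the whole line, as \<open>interval_measure\<close> requires.\<close>
  define F where "F t = A (max 0 (min T t))" for t
  have mono: "F s \<le> F t" if "s \<le> t" for s t
    unfolding F_def using that assms(4) by (intro mono_onD[OF assms(2)]) auto
  have "continuous_on UNIV F"
    unfolding F_def using assms(4)
    by (intro continuous_on_compose2[OF assms(1)] continuous_intros) auto
  then have right: "continuous (at_right t) F" for t
    by (simp add: continuous_on_eq_continuous_at continuous_at_imp_continuous_within)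
  let ?\<mu> = "restrict_space (interval_measure F) {0..T}"
  have Icc: "emeasure ?\<mu> {0..t} = ennreal (A t)" if t: "t \<in> {0..T}" for t
  proof -
    have "emeasure ?\<mu> {0..t} = emeasure (interval_measure F) {0..t}"
      using t by (subst emeasure_restrict_space) auto
    \<comment> \<open>Masses are known for left-open intervals only, so \<open>{0..t}\<close> is
      written as a difference. Any negative number could replace -1, because \<open>F\<close>
      vanishes to the left of 0 and the removed part is null.\<close>
    also have "\<dots> = emeasure (interval_measure F) {-1<..t}
        - emeasure (interval_measure F) {-1<..<0}"
    proof -
      have "emeasure (interval_measure F) {-1<..<0} \<le> emeasure (interval_measure F) {-1<..0}"
        by (intro emeasure_mono) auto
      then have "emeasure (interval_measure F) {-1<..<0} \<noteq> \<infinity>"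
        by (subst (asm) emeasure_interval_measure_Ioc[OF _ mono right]) (auto simp: top_unique)
      then have "emeasure (interval_measure F) ({-1<..t} - {-1<..<0})
          = emeasure (interval_measure F) {-1<..t} - emeasure (interval_measure F) {-1<..<0}"
        using t by (intro emeasure_Diff) auto
      moreover have "{-1<..t} - {-1<..<0} = {0..t}" by auto
      ultimately show ?thesis by simp
    qed
    also have "emeasure (interval_measure F) {-1<..<0} = 0"
    proof -
      have "emeasure (interval_measure F) {-1<..<0} \<le> emeasure (interval_measure F) {-1<..0}"
        by (intro emeasure_mono) auto
      also have "\<dots> = 0"
        using assms(4) by (subst emeasure_interval_measure_Ioc[OF _ mono right]) (auto simp: F_def)
      finally show ?thesis by simp
    qed
    also have "emeasure (interval_measure F) {-1<..t} = ennreal (A t)"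
      using t assms(3,4)
      by (subst emeasure_interval_measure_Ioc[OF _ mono right]) (auto simp: F_def)
    finally show ?thesis by simp
  qed
  show "sets ?\<mu> = sets (borel_on T)"
    unfolding borel_on_def by (intro sets_restrict_space_cong) simp
  then have "space ?\<mu> = {0..T}"
    by (rule space_eq_if_sets_borel_on)
  then show "finite_measure ?\<mu>"
    using Icc[of T] assms(4) by (intro finite_measureI) simp
  show "measure ?\<mu> {0..t} = A t" if "t \<in> {0..T}" for t
    using Icc[OF that] mono_onD[OF assms(2), of 0 t] assms(3,4) that by (simp add: measure_def)
qed

section \<open>Energy measures\<close>

definition incr_pow :: "real \<Rightarrow> real set \<Rightarrow> (real \<Rightarrow> real) \<Rightarrow> nat \<Rightarrow> real" where
  "incr_pow p P x i = \<bar>x (part_pt P (Suc i)) - x (part_pt P i)\<bar> powr p"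

lemma incr_pow_nonneg: "0 \<le> incr_pow p P x i"
  by (simp add: incr_pow_def)

lemma sets_energy_measure: "sets (energy_measure p T P x) = sets (borel_on T)"
  by (simp add: energy_measure_def)

lemma finite_measure_energy_measure:
  assumes "is_partition T P"
  shows "finite_measure (energy_measure p T P x)"
proof (rule finite_measureI)
  have "space (energy_measure p T P x) \<in> sets (borel_on T)"
    by (metis sets.top sets_energy_measure)
  then show "emeasure (energy_measure p T P x) (space (energy_measure p T P x)) \<noteq> \<infinity>"
    using assms by (subst emeasure_energy_measure) (auto simp: ennreal_mult_eq_top_iff indicator_def)
qed

lemma integral_energy_measure:
  fixes f :: "real \<Rightarrow> real"
  assumes "is_partition T P" "f \<in> borel_measurable (borel_on T)"
  shows "integral\<^sup>L (energy_measure p T P x) f = (\<Sum>i<part_N P. incr_pow p P x i * f (part_pt P i))"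
proof -
  let ?w = "\<lambda>i. ennreal (\<bar>x (part_pt P (Suc i)) - x (part_pt P i)\<bar> powr p)"
  have "part_pt P \<in> measurable (point_measure {..<part_N P} ?w) (borel_on T)"
    using part_pt_bounds[OF assms(1)]
    by (auto simp: measurable_def space_point_measure sets_point_measure space_borel_on)
  then have "integral\<^sup>L (energy_measure p T P x) f
      = integral\<^sup>L (point_measure {..<part_N P} ?w) (\<lambda>i. f (part_pt P i))"
    unfolding energy_measure_def using assms(2) by (rule integral_distr)
  also have "\<dots> = (\<Sum>i<part_N P. incr_pow p P x i * f (part_pt P i))"
    by (subst lebesgue_integral_point_measure_finite) (auto simp: incr_pow_def)
  finally show ?thesis .
qed

text \<open>The point masses sit at left endpoints, so an interval straddling \<open>t\<close> is
  counted with its full increment, whereas the stopped energy cuts it at \<open>t\<close>.\<close>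

lemma measure_energy_measure_Icc:
  assumes "is_partition T P" "t \<in> {0..T}"
  shows "measure (energy_measure p T P x) {0..t}
    = (\<Sum>i<part_N P. incr_pow p P x i * of_bool (part_pt P i \<le> t))"
proof -
  have set: "{0..t} \<in> sets (borel_on T)"
    using assms(2) by (auto simp: sets_borel_on_iff)
  have "space (energy_measure p T P x) = {0..T}"
    using space_eq_if_sets_borel_on[OF sets_energy_measure] .
  then have "measure (energy_measure p T P x) {0..t}
      = integral\<^sup>L (energy_measure p T P x) (indicator {0..t})"
    using assms(2) set by (simp add: Int_absorb2)
  also have "\<dots> = (\<Sum>i<part_N P. incr_pow p P x i * indicator {0..t} (part_pt P i))"
    using set by (intro integral_energy_measure[OF assms(1)]) simp
  also have "\<dots> = (\<Sum>i<part_N P. incr_pow p P x i * of_bool (part_pt P i \<le> t))"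
    using part_pt_bounds[OF assms(1)] by (intro sum.cong) (auto simp: indicator_def)
  finally show ?thesis .
qed

text \<open>Only the interval straddling \<open>t\<close> contributes to the difference.\<close>

lemma measure_energy_measure_stopped_energy:
  assumes P: "is_partition T P" and t: "t \<in> {0..T}" and "p > 0"
    and gap: "\<And>i. i < part_N P \<Longrightarrow> part_pt P (Suc i) - part_pt P i \<le> h"
    and osc: "\<And>s t. s \<in> {0..T} \<Longrightarrow> t \<in> {0..T} \<Longrightarrow> \<bar>t - s\<bar> \<le> h \<Longrightarrow> \<bar>x t - x s\<bar> \<le> e"
  shows "\<bar>measure (energy_measure p T P x) {0..t} - stopped_energy p P x t\<bar> \<le> e powr p"
proof -
  let ?S = "{i. i < part_N P \<and> part_pt P i \<le> t \<and> t < part_pt P (Suc i)}"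
  let ?v = "\<lambda>i. \<bar>x (min (part_pt P (Suc i)) t) - x (min (part_pt P i) t)\<bar> powr p"
  have bound: "\<bar>incr_pow p P x i * of_bool (part_pt P i \<le> t) - ?v i\<bar>
      \<le> e powr p * of_bool (i \<in> ?S)" if i: "i < part_N P" for i
  proof -
    have less: "part_pt P i < part_pt P (Suc i)"
      using part_pt_strict_mono[OF P] i by simp
    \<comment> \<open>To the left of \<open>t\<close> the two terms agree, to the right both vanish,
      and for a straddling interval both lie between 0 and \<open>e powr p\<close>.\<close>
    consider "part_pt P (Suc i) \<le> t" | "i \<in> ?S" | "t < part_pt P i"
      using i by force
    then show ?thesis
    proof cases
      case 1
      then show ?thesis using less by (simp add: incr_pow_def)
    next
      case 2
      have b: "part_pt P i \<in> {0..T}" "part_pt P (Suc i) \<in> {0..T}"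
        using part_pt_bounds[OF P] i by auto
      have "incr_pow p P x i \<le> e powr p"
        unfolding incr_pow_def using osc[OF b] gap[OF i] less \<open>p > 0\<close>
        by (intro powr_mono2) auto
      moreover have "?v i \<le> e powr p"
        using osc[OF b(1) t] gap[OF i] 2 \<open>p > 0\<close>
        by (intro powr_mono2) (auto simp: min_def)
      moreover have "0 \<le> ?v i" by simp
      moreover have "\<bar>a - b\<bar> \<le> c" if "0 \<le> a" "a \<le> c" "0 \<le> b" "b \<le> c" for a b c :: real
        using that by linarith
      ultimately have "\<bar>incr_pow p P x i - ?v i\<bar> \<le> e powr p"
        using incr_pow_nonneg by blast
      then show ?thesis
        using 2 by simp
    next
      case 3
      then show ?thesis using less \<open>p > 0\<close> by (simp add: min_def)
    qed
  qed
  have "\<bar>measure (energy_measure p T P x) {0..t} - stopped_energy p P x t\<bar>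
      \<le> (\<Sum>i<part_N P. e powr p * of_bool (i \<in> ?S))"
    unfolding measure_energy_measure_Icc[OF P t] stopped_energy_def sum_subtractf[symmetric]
    using bound by (intro order_trans[OF sum_abs] sum_mono) auto
  also have "\<dots> = e powr p * real (card ?S)"
    by (simp add: sum_distrib_left[symmetric] sum.If_cases of_bool_def Int_def)
  also have "\<dots> \<le> e powr p * 1"
    using card_straddling_le_1[OF P, of t] by (intro mult_left_mono) auto
  finally show ?thesis by simp
qed

text \<open>At \<delta> = \<open>l n\<close> the iterated supremum in
  \<open>is_rough_variation\<close> includes the pair \<open>l n\<close>, \<open>a n\<close> and the
  time \<open>t\<close>, so it dominates the error and a squeeze applies.\<close>

lemma stopped_energy_grid_tendsto:
  assumes "T > 0" "is_rough_variation p T x A" "t \<in> {0..T}"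
    and l: "\<And>n. 0 < l n \<and> l n \<le> T" "l \<longlonglongrightarrow> 0" and a: "\<And>n. 0 \<le> a n \<and> a n < l n"
  shows "(\<lambda>n. stopped_energy p (shifted_grid T (l n) (a n)) x t) \<longlonglongrightarrow> A t"
proof -
  let ?F = "\<lambda>\<delta>. SUP l\<in>{l. 0 < l \<and> l \<le> T \<and> l \<le> \<delta>}. SUP a\<in>{0..<l}. SUP t\<in>{0..T}.
         ereal \<bar>stopped_energy p (shifted_grid T l a) x t - A t\<bar>"
  have "filterlim l (at_right 0) sequentially"
    using l by (auto simp: filterlim_at less_imp_neq[symmetric] intro!: always_eventually)
  moreover have "(?F \<longlongrightarrow> 0) (at_right 0)"
    using assms(2) by (simp add: is_rough_variation_def)
  ultimately have lim: "(\<lambda>n. ?F (l n)) \<longlonglongrightarrow> 0"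
    by (rule filterlim_compose[rotated])
  have ev: "\<forall>\<^sub>F n in sequentially.
      ereal \<bar>stopped_energy p (shifted_grid T (l n) (a n)) x t - A t\<bar> \<le> ?F (l n)"
  proof (rule always_eventually, rule allI)
    fix n
    show "ereal \<bar>stopped_energy p (shifted_grid T (l n) (a n)) x t - A t\<bar> \<le> ?F (l n)"
      by (rule SUP_upper2[of "l n"], use l in simp,
          rule SUP_upper2[of "a n"], use a in simp,
          rule SUP_upper2[of t], use assms(3) in auto)
  qed
  have "(\<lambda>n. ereal \<bar>stopped_energy p (shifted_grid T (l n) (a n)) x t - A t\<bar>) \<longlonglongrightarrow> 0"
    by (rule tendsto_sandwich[OF _ ev tendsto_const lim]) simp
  then have "(\<lambda>n. \<bar>stopped_energy p (shifted_grid T (l n) (a n)) x t - A t\<bar>) \<longlonglongrightarrow> 0"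
    unfolding zero_ereal_def lim_ereal .
  then show ?thesis
    by (simp add: tendsto_rabs_zero_iff LIM_zero_iff)
qed

lemma measure_energy_measure_grid_tendsto:
  assumes "p > 0" "T > 0" "continuous_on {0..T} x" "is_rough_variation p T x A" "t \<in> {0..T}"
    and l: "\<And>n. 0 < l n \<and> l n \<le> T" "l \<longlonglongrightarrow> 0" and a: "\<And>n. 0 \<le> a n \<and> a n < l n"
  shows "(\<lambda>n. measure (energy_measure p T (shifted_grid T (l n) (a n)) x) {0..t}) \<longlonglongrightarrow> A t"
proof -
  let ?P = "\<lambda>n. shifted_grid T (l n) (a n)"
  have "(\<lambda>n. measure (energy_measure p T (?P n) x) {0..t} - stopped_energy p (?P n) x t)
      \<longlonglongrightarrow> 0"
  proof (rule tendstoI)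
    fix r :: real assume "r > 0"
    \<comment> \<open>Solves \<open>e powr p = r / 2\<close>, so that the single straddling
      increment costs less than \<open>r\<close>.\<close>
    define e where "e = (r / 2) powr (1 / p)"
    have "e > 0" "e powr p = r / 2"
      using \<open>r > 0\<close> \<open>p > 0\<close> by (simp_all add: e_def powr_powr)
    have "uniformly_continuous_on {0..T} x"
      using assms(3) by (intro compact_uniformly_continuous) auto
    then obtain d where "d > 0"
      and d: "\<And>s t. s \<in> {0..T} \<Longrightarrow> t \<in> {0..T} \<Longrightarrow> \<bar>t - s\<bar> < d \<Longrightarrow> \<bar>x t - x s\<bar> < e"
      unfolding uniformly_continuous_on_def dist_real_def using \<open>e > 0\<close> by metis
    have "\<forall>\<^sub>F n in sequentially. l n < d"
      using order_tendstoD(2)[OF l(2) \<open>d > 0\<close>] .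
    then show "\<forall>\<^sub>F n in sequentially.
        dist (measure (energy_measure p T (?P n) x) {0..t} - stopped_energy p (?P n) x t) 0 < r"
    proof eventually_elim
      case (elim n)
      have "\<bar>measure (energy_measure p T (?P n) x) {0..t} - stopped_energy p (?P n) x t\<bar>
          \<le> e powr p"
      proof (rule measure_energy_measure_stopped_energy[where h = "l n"])
        show "\<bar>x t - x s\<bar> \<le> e" if "s \<in> {0..T}" "t \<in> {0..T}" "\<bar>t - s\<bar> \<le> l n" for s t
          using d[of s t] that elim by force
      qed (use assms l a in \<open>auto intro: is_partition_shifted_grid shifted_grid_gap_le\<close>)
      then show ?case
        using \<open>r > 0\<close> \<open>e powr p = r / 2\<close> by (simp add: dist_real_def)
    qed
  qed
  from tendsto_add[OF this stopped_energy_grid_tendsto[OF assms(2,4,5) l a]]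
  show ?thesis by simp
qed

section \<open>Perturbation of the partition points\<close>

text \<open>If \<bar>u - v\<bar> is at most \<eta>\<bar>v\<bar>, then \<bar>u\<bar> lies between (1
  - \<eta>)\<bar>v\<bar> and (1 + \<eta>)\<bar>v\<bar>, and continuity of the power at 1 makes both
  factors harmless for small \<eta>. Otherwise \<bar>u\<bar> and \<bar>v\<bar> are both bounded by
  multiples of \<bar>u - v\<bar>.\<close>

lemma abs_powr_perturbation:
  fixes p e :: real
  assumes "p > 0" "e > 0"
  obtains C where "C \<ge> 0"
    "\<And>u v. \<bar>\<bar>u\<bar> powr p - \<bar>v\<bar> powr p\<bar> \<le> e * \<bar>v\<bar> powr p + C * \<bar>u - v\<bar> powr p"
proof -
  have lim: "((\<lambda>\<eta>. (1 + \<eta>) powr p) \<longlongrightarrow> (1 + 0) powr p) (at_right (0::real))"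
    "((\<lambda>\<eta>. (1 - \<eta>) powr p) \<longlongrightarrow> (1 - 0) powr p) (at_right (0::real))"
    by (intro tendsto_intros; simp)+
  have "\<forall>\<^sub>F \<eta> in at_right (0::real). (1 + \<eta>) powr p < 1 + e"
    "\<forall>\<^sub>F \<eta> in at_right (0::real). 1 - e < (1 - \<eta>) powr p"
    using \<open>e > 0\<close> order_tendstoD(2)[OF lim(1), of "1 + e"] order_tendstoD(1)[OF lim(2), of "1 - e"]
    by simp_all
  moreover have "\<forall>\<^sub>F \<eta> in at_right (0::real). 0 < \<eta> \<and> \<eta> < 1"
    using eventually_at_right_real[of 0 "1::real"] by simp
  ultimately have "\<forall>\<^sub>F \<eta> in at_right (0::real).
      (1 + \<eta>) powr p < 1 + e \<and> 1 - e < (1 - \<eta>) powr p \<and> 0 < \<eta> \<and> \<eta> < 1"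
    by eventually_elim auto
  then obtain \<eta> :: real where \<eta>: "(1 + \<eta>) powr p < 1 + e" "1 - e < (1 - \<eta>) powr p" "0 < \<eta>" "\<eta> < 1"
    using eventually_happens[of _ "at_right (0::real)"] by auto
  \<comment> \<open>The two summands are the constants for \<bar>u\<bar> and for \<bar>v\<bar> in
    the case where \<bar>u - v\<bar> exceeds \<eta>\<bar>v\<bar>.\<close>
  define C where "C = (1 + 1 / \<eta>) powr p + (1 / \<eta>) powr p"
  have "\<bar>\<bar>u\<bar> powr p - \<bar>v\<bar> powr p\<bar> \<le> e * \<bar>v\<bar> powr p + C * \<bar>u - v\<bar> powr p" for u v
  proof (cases "\<bar>u - v\<bar> \<le> \<eta> * \<bar>v\<bar>")
    case True
    have "\<bar>u\<bar> \<le> (1 + \<eta>) * \<bar>v\<bar>" "(1 - \<eta>) * \<bar>v\<bar> \<le> \<bar>u\<bar>"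
      using True by (auto simp: algebra_simps)
    then have "\<bar>u\<bar> powr p \<le> ((1 + \<eta>) * \<bar>v\<bar>) powr p" "((1 - \<eta>) * \<bar>v\<bar>) powr p \<le> \<bar>u\<bar> powr p"
      using \<open>p > 0\<close> \<eta> by (auto intro!: powr_mono2)
    moreover have "((1 + \<eta>) * \<bar>v\<bar>) powr p \<le> (1 + e) * \<bar>v\<bar> powr p"
      "(1 - e) * \<bar>v\<bar> powr p \<le> ((1 - \<eta>) * \<bar>v\<bar>) powr p"
      using \<eta> by (auto simp: powr_mult intro!: mult_right_mono)
    ultimately have "\<bar>\<bar>u\<bar> powr p - \<bar>v\<bar> powr p\<bar> \<le> e * \<bar>v\<bar> powr p"
      by (auto simp: abs_le_iff algebra_simps)
    moreover have "0 \<le> C * \<bar>u - v\<bar> powr p"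
      by (simp add: C_def)
    ultimately show ?thesis by linarith
  next
    case False
    then have v: "\<bar>v\<bar> \<le> (1 / \<eta>) * \<bar>u - v\<bar>"
      using \<eta> by (simp add: field_simps)
    then have "\<bar>u\<bar> \<le> (1 + 1 / \<eta>) * \<bar>u - v\<bar>"
      by (simp add: algebra_simps)
    then have "\<bar>u\<bar> powr p \<le> ((1 + 1 / \<eta>) * \<bar>u - v\<bar>) powr p"
      using \<open>p > 0\<close> by (intro powr_mono2) auto
    moreover have "\<bar>v\<bar> powr p \<le> ((1 / \<eta>) * \<bar>u - v\<bar>) powr p"
      using \<open>p > 0\<close> v by (intro powr_mono2) auto
    ultimately have "\<bar>u\<bar> powr p + \<bar>v\<bar> powr p \<le> C * \<bar>u - v\<bar> powr p"
      unfolding C_def powr_mult distrib_right[of "(1 + 1 / \<eta>) powr p"] by (rule add_mono)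
    moreover have "0 \<le> e * \<bar>v\<bar> powr p" "0 \<le> \<bar>u\<bar> powr p" "0 \<le> \<bar>v\<bar> powr p"
      using \<open>e > 0\<close> by simp_all
    ultimately show ?thesis by linarith
  qed
  then show thesis
    using that[of C] by (simp add: C_def)
qed

text \<open>Summing the perturbation inequality leaves \<open>e\<close> times the bounded grid
  energy plus a constant times the number of intervals times the \<open>p\<close>-th power of the
  modulus. The growth condition \<open>lim\<close> removes the second part.\<close>

lemma incr_pow_diff_sum_tendsto_0:
  assumes "p > 0" "continuous_on {0..T} x"
    and P: "\<And>n. is_partition T (P n)" and Q: "\<And>n. is_partition T (Q n)"
    and N: "\<And>n. part_N (P n) = part_N (Q n)"
    and lim: "(\<lambda>n. real (part_N (P n)) * modulus T x (part_dist (P n) (Q n)) powr p) \<longlonglongrightarrow> 0"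
    and bdd: "\<And>n. (\<Sum>i<part_N (Q n). incr_pow p (Q n) x i) \<le> B"
  shows "(\<lambda>n. \<Sum>i<part_N (Q n). \<bar>incr_pow p (P n) x i - incr_pow p (Q n) x i\<bar>) \<longlonglongrightarrow> 0"
proof (rule tendstoI)
  fix r :: real assume "r > 0"
  have "0 \<le> B"
    using bdd[of 0] by (meson incr_pow_nonneg order_trans sum_nonneg)
  \<comment> \<open>The summand 1 keeps the denominator positive when \<open>B\<close> is 0 and
    makes \<open>e * B < r / 2\<close> strict.\<close>
  define e where "e = r / (2 * (B + 1))"
  have "e > 0" and eB: "e * B < r / 2"
    using \<open>r > 0\<close> \<open>B \<ge> 0\<close> by (simp_all add: e_def field_simps)
  obtain C where C: "C \<ge> 0"
    "\<And>u v. \<bar>\<bar>u\<bar> powr p - \<bar>v\<bar> powr p\<bar> \<le> e * \<bar>v\<bar> powr p + C * \<bar>u - v\<bar> powr p"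
    using abs_powr_perturbation[OF \<open>p > 0\<close> \<open>e > 0\<close>] by blast
  let ?\<omega> = "\<lambda>n. modulus T x (part_dist (P n) (Q n))"
  have bound: "(\<Sum>i<part_N (Q n). \<bar>incr_pow p (P n) x i - incr_pow p (Q n) x i\<bar>)
      \<le> e * B + C * 2 powr p * (real (part_N (P n)) * ?\<omega> n powr p)" for n
  proof -
    have pt: "\<bar>x (part_pt (P n) i) - x (part_pt (Q n) i)\<bar> \<le> ?\<omega> n" if "i \<le> part_N (Q n)" for i
      using that part_pt_bounds[OF P] part_pt_bounds[OF Q] N part_dist_ge[of i "P n" "Q n"]
      by (intro modulus_ge[OF assms(2)]) auto
    have "(\<Sum>i<part_N (Q n). \<bar>incr_pow p (P n) x i - incr_pow p (Q n) x i\<bar>)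
      \<le> (\<Sum>i<part_N (Q n). e * incr_pow p (Q n) x i + C * (2 * ?\<omega> n) powr p)"
    proof (rule sum_mono)
      fix i assume "i \<in> {..<part_N (Q n)}"
      then have "\<bar>(x (part_pt (P n) (Suc i)) - x (part_pt (P n) i))
          - (x (part_pt (Q n) (Suc i)) - x (part_pt (Q n) i))\<bar> \<le> 2 * ?\<omega> n"
        using pt[of i] pt[of "Suc i"] by auto
      then have "\<bar>(x (part_pt (P n) (Suc i)) - x (part_pt (P n) i))
          - (x (part_pt (Q n) (Suc i)) - x (part_pt (Q n) i))\<bar> powr p \<le> (2 * ?\<omega> n) powr p"
        using \<open>p > 0\<close> by (intro powr_mono2) auto
      then show "\<bar>incr_pow p (P n) x i - incr_pow p (Q n) x i\<bar>
          \<le> e * incr_pow p (Q n) x i + C * (2 * ?\<omega> n) powr p"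
        unfolding incr_pow_def using C(1) by (intro order_trans[OF C(2)] add_left_mono mult_left_mono)
    qed
    also have "\<dots> = e * (\<Sum>i<part_N (Q n). incr_pow p (Q n) x i)
        + C * 2 powr p * (real (part_N (P n)) * ?\<omega> n powr p)"
      using pt[of 0] by (simp add: sum.distrib sum_distrib_left powr_mult N)
    also have "e * (\<Sum>i<part_N (Q n). incr_pow p (Q n) x i) \<le> e * B"
      using bdd[of n] \<open>e > 0\<close> by simp
    finally show ?thesis by simp
  qed
  have "(\<lambda>n. C * 2 powr p * (real (part_N (P n)) * ?\<omega> n powr p)) \<longlonglongrightarrow> C * 2 powr p * 0"
    by (intro tendsto_mult_left lim)
  then have "\<forall>\<^sub>F n in sequentially. C * 2 powr p * (real (part_N (P n)) * ?\<omega> n powr p) < r / 2"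
    using \<open>r > 0\<close> by (intro order_tendstoD(2)) auto
  then show "\<forall>\<^sub>F n in sequentially.
      dist (\<Sum>i<part_N (Q n). \<bar>incr_pow p (P n) x i - incr_pow p (Q n) x i\<bar>) 0 < r"
  proof eventually_elim
    case (elim n)
    then show ?case
      using bound[of n] eB by (simp add: dist_real_def sum_nonneg)
  qed
qed

text \<open>Two things change between the measures: the weights, controlled by the preceding sum,
  and the sites of the point masses, which move by at most \<open>part_dist\<close> and are
  controlled by uniform continuity of \<open>f\<close>.\<close>

lemma integral_energy_measure_perturbation:
  fixes f :: "real \<Rightarrow> real"
  assumes "p > 0" "continuous_on {0..T} x" "continuous_on {0..T} f"
    and P: "\<And>n. is_partition T (P n)" and Q: "\<And>n. is_partition T (Q n)"
    and N: "\<And>n. part_N (P n) = part_N (Q n)"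
    and dist: "(\<lambda>n. part_dist (P n) (Q n)) \<longlonglongrightarrow> 0"
    and lim: "(\<lambda>n. real (part_N (P n)) * modulus T x (part_dist (P n) (Q n)) powr p) \<longlonglongrightarrow> 0"
    and bdd: "\<And>n. (\<Sum>i<part_N (Q n). incr_pow p (Q n) x i) \<le> B"
  shows "(\<lambda>n. integral\<^sup>L (energy_measure p T (P n) x) f
            - integral\<^sup>L (energy_measure p T (Q n) x) f) \<longlonglongrightarrow> 0"
proof (rule tendstoI)
  fix r :: real assume "r > 0"
  have "0 \<le> B"
    using bdd[of 0] by (meson incr_pow_nonneg order_trans sum_nonneg)
  define e where "e = r / (2 * (B + 1))"
  have "e > 0" and eB: "e * B < r / 2"
    using \<open>r > 0\<close> \<open>B \<ge> 0\<close> by (simp_all add: e_def field_simps)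
  have "bounded (f ` {0..T})"
    using assms(3) by (intro compact_imp_bounded compact_continuous_image) auto
  then obtain K where K: "\<And>u. u \<in> {0..T} \<Longrightarrow> \<bar>f u\<bar> \<le> K"
    unfolding bounded_iff real_norm_def by blast
  have "uniformly_continuous_on {0..T} f"
    using assms(3) by (intro compact_uniformly_continuous) auto
  then obtain d where "d > 0"
    and d: "\<And>s t. s \<in> {0..T} \<Longrightarrow> t \<in> {0..T} \<Longrightarrow> \<bar>t - s\<bar> < d \<Longrightarrow> \<bar>f t - f s\<bar> < e"
    unfolding uniformly_continuous_on_def dist_real_def using \<open>e > 0\<close> by metis
  have f: "f \<in> borel_measurable (borel_on T)"
    using measurable_if_continuous_borel_on assms(3) by blast
  let ?D = "\<lambda>n. \<Sum>i<part_N (Q n). \<bar>incr_pow p (P n) x i - incr_pow p (Q n) x i\<bar>"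
  have "(\<lambda>n. K * ?D n) \<longlonglongrightarrow> K * 0"
    by (intro tendsto_mult_left incr_pow_diff_sum_tendsto_0[OF assms(1,2) P Q N lim bdd])
  then have "\<forall>\<^sub>F n in sequentially. K * ?D n < r / 2"
    using \<open>r > 0\<close> by (intro order_tendstoD(2)) auto
  moreover have "\<forall>\<^sub>F n in sequentially. part_dist (P n) (Q n) < d"
    using order_tendstoD(2)[OF dist \<open>d > 0\<close>] .
  ultimately show "\<forall>\<^sub>F n in sequentially. dist (integral\<^sup>L (energy_measure p T (P n) x) f
            - integral\<^sup>L (energy_measure p T (Q n) x) f) 0 < r"
  proof eventually_elim
    case (elim n)
    let ?u = "incr_pow p (P n) x" and ?v = "incr_pow p (Q n) x"
    let ?s = "part_pt (P n)" and ?t = "part_pt (Q n)"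
    have "\<bar>integral\<^sup>L (energy_measure p T (P n) x) f - integral\<^sup>L (energy_measure p T (Q n) x) f\<bar>
        = \<bar>\<Sum>i<part_N (Q n). ?u i * f (?s i) - ?v i * f (?t i)\<bar>"
      by (simp add: integral_energy_measure[OF P f] integral_energy_measure[OF Q f] N sum_subtractf)
    \<comment> \<open>Each term splits into a change of weight at the new site and a change of site
      with the grid weight.\<close>
    also have "\<dots> \<le> (\<Sum>i<part_N (Q n). K * \<bar>?u i - ?v i\<bar> + e * ?v i)"
    proof (intro order_trans[OF sum_abs] sum_mono)
      fix i assume i: "i \<in> {..<part_N (Q n)}"
      have b: "?s i \<in> {0..T}" "?t i \<in> {0..T}"
        using part_pt_bounds[OF P] part_pt_bounds[OF Q] N i by auto
      have "\<bar>f (?s i) - f (?t i)\<bar> \<le> e"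
        using d[OF b(2,1)] part_dist_ge[of i "P n" "Q n"] elim(2) N i by fastforce
      then have "\<bar>?v i * (f (?s i) - f (?t i))\<bar> \<le> ?v i * e"
        using incr_pow_nonneg[of p "Q n" x i] by (simp add: abs_mult mult_left_mono)
      moreover have "\<bar>(?u i - ?v i) * f (?s i)\<bar> \<le> \<bar>?u i - ?v i\<bar> * K"
        using K[OF b(1)] by (simp add: abs_mult mult_left_mono)
      moreover have "?u i * f (?s i) - ?v i * f (?t i)
          = (?u i - ?v i) * f (?s i) + ?v i * (f (?s i) - f (?t i))"
        by (simp add: algebra_simps)
      ultimately show "\<bar>?u i * f (?s i) - ?v i * f (?t i)\<bar> \<le> K * \<bar>?u i - ?v i\<bar> + e * ?v i"
        by (simp only: mult.commute[of K] mult.commute[of e])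
    qed
    also have "\<dots> = K * ?D n + e * (\<Sum>i<part_N (Q n). ?v i)"
      by (simp add: sum.distrib sum_distrib_left)
    also have "e * (\<Sum>i<part_N (Q n). ?v i) \<le> e * B"
      using bdd[of n] \<open>e > 0\<close> by simp
    finally show ?case
      using elim(1) eB by (simp add: dist_real_def)
  qed
qed

section \<open>Identification of the limit measure along the perturbed partitions\<close>

theorem theorem5p5:
  fixes p T :: real and x :: "real \<Rightarrow> real"
    and l a :: "nat \<Rightarrow> real" and \<pi> :: "nat \<Rightarrow> real set"
  assumes "p > 1" and "T > 0"
    and "continuous_on {0..T} x"
    and "p_rough p T x"
    and "\<And>n. 0 < l n \<and> l n \<le> T" and "l \<longlonglongrightarrow> 0"
    and "\<And>n. 0 \<le> a n \<and> a n < l n"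
    and "\<And>n. is_partition T (\<pi> n)"
    and "\<And>n. part_N (\<pi> n) = part_N (shifted_grid T (l n) (a n))"
    and "(\<lambda>n. part_dist (\<pi> n) (shifted_grid T (l n) (a n))) \<longlonglongrightarrow> 0"
    and "(\<lambda>n. real (part_N (\<pi> n)) *
           modulus T x (part_dist (\<pi> n) (shifted_grid T (l n) (a n))) powr p) \<longlonglongrightarrow> 0"
  shows "x \<in> Vp p T \<pi> \<and>
         (\<forall>t\<in>{0..T}. variation_along p T \<pi> x t = rough_variation p T x t)"
proof -
  let ?Q = "\<lambda>n. shifted_grid T (l n) (a n)"
  have Q: "is_partition T (?Q n)" for n
    using assms(5,7) by (intro is_partition_shifted_grid) auto
  have "p > 0" using assms(1) by simp
  obtain A where A: "is_rough_variation p T x A"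
    using assms(4) by (auto simp: p_rough_def)
  then obtain \<mu> where \<mu>: "sets \<mu> = sets (borel_on T)" "finite_measure \<mu>"
    and \<mu>A: "\<And>t. t \<in> {0..T} \<Longrightarrow> measure \<mu> {0..t} = A t"
    using obtain_measure_of_continuous_mono[of T A] assms(2) by (auto simp: is_rough_variation_def)
  have cdf: "(\<lambda>n. measure (energy_measure p T (?Q n) x) {0..t}) \<longlonglongrightarrow> measure \<mu> {0..t}"
    if "t \<in> {0..T}" for t
    unfolding \<mu>A[OF that]
    by (rule measure_energy_measure_grid_tendsto[OF \<open>p > 0\<close> assms(2,3) A that assms(5-7)])
  have grid: "weakly_converges T (\<lambda>n. energy_measure p T (?Q n) x) \<mu>"
    by (rule weakly_converges_if_measure_Icc_tendsto[OF sets_energy_measure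
          finite_measure_energy_measure[OF Q] \<mu> cdf assms(2)])
  have "(\<lambda>n. measure (energy_measure p T (?Q n) x) {0..T}) \<longlonglongrightarrow> measure \<mu> {0..T}"
    using assms(2) by (intro cdf) simp
  \<comment> \<open>Convergence of the total masses yields the bound on the grid energies, uniform
    in \<open>n\<close>, that the perturbation argument needs.\<close>
  then have "Bseq (\<lambda>n. measure (energy_measure p T (?Q n) x) {0..T})"
    by (intro convergent_imp_Bseq convergentI)
  then obtain B where "\<And>n. \<bar>measure (energy_measure p T (?Q n) x) {0..T}\<bar> \<le> B"
    by (auto simp: Bseq_def)
  moreover have "measure (energy_measure p T (?Q n) x) {0..T}
      = (\<Sum>i<part_N (?Q n). incr_pow p (?Q n) x i)" for n
    using part_pt_bounds[OF Q] assms(2)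
    by (subst measure_energy_measure_Icc[OF Q]) (auto intro!: sum.cong)
  ultimately have bdd: "(\<Sum>i<part_N (?Q n). incr_pow p (?Q n) x i) \<le> B" for n
    by (metis abs_le_D1)
  have weak: "weakly_converges T (\<lambda>n. energy_measure p T (\<pi> n) x) \<mu>"
    unfolding weakly_converges_def
  proof (intro allI impI)
    fix f :: "real \<Rightarrow> real" assume f: "continuous_on {0..T} f"
    then have "(\<lambda>n. integral\<^sup>L (energy_measure p T (?Q n) x) f) \<longlonglongrightarrow> integral\<^sup>L \<mu> f"
      using grid by (simp add: weakly_converges_def)
    from tendsto_add[OF integral_energy_measure_perturbation[OF \<open>p > 0\<close> assms(3) f
          assms(8) Q assms(9-11) bdd] this]
    show "(\<lambda>n. integral\<^sup>L (energy_measure p T (\<pi> n) x) f) \<longlonglongrightarrow> integral\<^sup>L \<mu> f"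
      by simp
  qed
  have "nonatomic \<mu>"
  proof (rule nonatomic_if_continuous_Icc[OF \<mu>])
    have "continuous_on {0..T} A"
      using A by (simp add: is_rough_variation_def)
    then show "continuous_on {0..T} (\<lambda>t. measure \<mu> {0..t})"
      by (rule continuous_on_eq) (simp add: \<mu>A)
    \<comment> \<open>Continuity of the distribution function on [0,T] does not exclude an atom at
      0; the normalisation \<open>A 0 = 0\<close> does.\<close>
    show "measure \<mu> {0..0} = 0"
      using \<mu>A[of 0] A assms(2) by (simp add: is_rough_variation_def)
  qed (use assms(2) in simp)
  then have lim: "is_limit_measure p T \<pi> x \<mu>"
    using \<mu> weak by (simp add: is_limit_measure_def)
  then have "limit_measure p T \<pi> x = \<mu>"
    unfolding limit_measure_def using is_limit_measure_unique assms(2)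
    by (intro the_equality) auto
  moreover have "(\<lambda>n. mesh (\<pi> n)) \<longlonglongrightarrow> 0"
  proof (rule tendsto_sandwich[OF _ _ tendsto_const])
    show "\<forall>\<^sub>F n in sequentially. 0 \<le> mesh (\<pi> n)"
      using mesh_nonneg[OF assms(8,2)] by simp
    \<comment> \<open>The grid gaps are at most \<open>l n\<close>, and the displacement of the
      points adds at most twice \<open>part_dist\<close>.\<close>
    show "\<forall>\<^sub>F n in sequentially. mesh (\<pi> n) \<le> l n + 2 * part_dist (\<pi> n) (?Q n)"
      using assms(5,7)
      by (intro always_eventually allI mesh_le_gap_plus_part_dist[OF assms(8,2,9)]
            shifted_grid_gap_le) auto
    show "(\<lambda>n. l n + 2 * part_dist (\<pi> n) (?Q n)) \<longlonglongrightarrow> 0"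
      using tendsto_add[OF assms(6) tendsto_mult_left[OF assms(10), of 2]] by simp
  qed
  ultimately show ?thesis
    using lim assms(3,8) \<mu>A rough_variation_eqI[OF assms(2) A]
    by (auto simp: Vp_def variation_along_def)
qed

end
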